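(* Let $t, r$ be integers with $1 \leq t \leq r$, let $k \geq 2$, and let $\mathcal{H}$ be a hereditary family with $\mu(\mathcal{H}) \geq \max\{n_{\rm S}(r,t), (k^{1/t}+1)r\}$. For each $i \in [k]$, let $\emptyset \neq S_i \subseteq [t,r]$ and $\mathcal{F}_i := \bigcup_{s \in S_i}\mathcal{H}^{(s)}$. Let $\mathcal{A}_1, \dots, \mathcal{A}_k$ be cross-$t$-intersecting families such that $\mathcal{A}_i \subseteq \mathcal{F}_i$ for all $i \in [k]$, and let $j \in [k]$ be such that $|\mathcal{F}_i| \leq |\mathcal{F}_j|$ for all $i \in [k]$. Then \[\sum_{i = 1}^k |\mathcal{A}_i| \leq |\mathcal{F}_j|,\] and equality holds if and only if, for some $l \in [k]$ such that $|\mathcal{F}_l| = |\mathcal{F}_j|$, $\mathcal{A}_l = \mathcal{F}_l$ and $\mathcal{A}_i = \emptyset$ for all $i \in [k] \setminus \{l\}$.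
   Context: All sets and families are finite. For integers $m \le n$, $[m,n] := \{i \in \{1,2,\dots\} : m \le i \le n\}$ and $[n] := [1,n]$. A family $\mathcal{H}$ is hereditary if every subset of every member of $\mathcal{H}$ is a member of $\mathcal{H}$. A base of a family $\mathcal{F}$ is a set $B \in \mathcal{F}$ that is not a proper subset of any member of $\mathcal{F}$; $\mu(\mathcal{F})$ denotes the size of a smallest base of $\mathcal{F}$. $\mathcal{H}^{(s)} := \{H \in \mathcal{H} : |H| = s\}$. A set $A$ $t$-intersects $B$ if $|A\cap B| \ge t$. Families $\mathcal{A}_1,\dots,\mathcal{A}_k$ are cross-$t$-intersecting if for all distinct $i,j \in [k]$, every set in $\mathcal{A}_i$ $t$-intersects every set in $\mathcal{A}_j$. Define $m(r,t) := \max\{2r, \frac{(r-t)(r-t+5)}{2} + (t-1)\}$ and $n_{\rm S}(r,t) := (r-t+1)\binom{m(r,t)}{t+1} + r$. *)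

theory Defs
  imports Complex_Main
begin

definition hereditary :: "'a set set \<Rightarrow> bool" where
  "hereditary H \<longleftrightarrow> (\<forall>A\<in>H. \<forall>B. B \<subseteq> A \<longrightarrow> B \<in> H)"

definition is_base :: "'a set set \<Rightarrow> 'a set \<Rightarrow> bool" where
  "is_base F B \<longleftrightarrow> B \<in> F \<and> \<not> (\<exists>C\<in>F. B \<subset> C)"

text \<open>Meaningful for finite nonempty families of finite sets; such a family has a base.
  For the empty family the value is unspecified.\<close>

definition mu :: "'a set set \<Rightarrow> nat" where
  "mu F = Min (card ` {B. is_base F B})"

definition level :: "'a set set \<Rightarrow> nat \<Rightarrow> 'a set set" where
  "level H s = {A \<in> H. card A = s}"

text \<open>Intended for finite sets, since \<^const>\<open>card\<close> is 0 on infinite ones.\<close>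

definition t_intersects :: "nat \<Rightarrow> 'a set \<Rightarrow> 'a set \<Rightarrow> bool" where
  "t_intersects t A B \<longleftrightarrow> t \<le> card (A \<inter> B)"

definition cross_t_intersecting ::
    "nat \<Rightarrow> 'i set \<Rightarrow> ('i \<Rightarrow> 'a set set) \<Rightarrow> bool" where
  "cross_t_intersecting t I \<A> \<longleftrightarrow>
     (\<forall>i\<in>I. \<forall>j\<in>I. i \<noteq> j \<longrightarrow> (\<forall>A\<in>\<A> i. \<forall>B\<in>\<A> j. t_intersects t A B))"

text \<open>The two functions below are used for \<open>1 \<le> t \<le> r\<close> only, so no subtraction truncates.
  The division is exact because \<open>d * (d + 5)\<close> is always even.\<close>

definition m_fun :: "nat \<Rightarrow> nat \<Rightarrow> nat" where
  "m_fun r t = max (2 * r) ((r - t) * (r - t + 5) div 2 + (t - 1))"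

definition n_S :: "nat \<Rightarrow> nat \<Rightarrow> nat" where
  "n_S r t = (r - t + 1) * (m_fun r t choose (t + 1)) + r"

end

theory Submission
  imports Defs
begin

text \<open>If at most one of the families is nonempty, the claim is immediate; otherwise the sum is
  strictly smaller than \<open>|\<F> j|\<close>. Put \<open>N = \<mu>(H) - r\<close> and \<open>c = (r choose t)\<close>. Exchanging the elements of
  a set for elements of a base above it shows that prescribing \<open>t\<close> elements cuts \<open>|\<F> i|\<close> down by a
  factor of at least \<open>(N choose t) / c + 1 > max k (2 * c)\<close>, and prescribing one more element cuts it
  down by a further factor of \<open>N / (r - t)\<close>. If all members of all the families contain a common
  \<open>t\<close>-set, each family is thus smaller than \<open>|\<F> j| / k\<close>. If a common \<open>t\<close>-set exists for all families but
  one, that family lies in a union of \<open>c\<close> stars of \<open>t\<close>-sets, while the other families lie in unions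
  of \<open>r\<close> stars of \<open>(t+1)\<close>-sets. If no such \<open>t\<close>-set exists, every family lies in a union of \<open>c * r\<close> stars
  of \<open>(t+1)\<close>-sets.\<close>

section \<open>Exchanging elements inside a large base\<close>

lemma ex_base_ge_mu:
  assumes "finite H" "A \<in> H"
  obtains B where "B \<in> H" "A \<subseteq> B" "mu H \<le> card B"
proof -
  from finite_has_maximal2[OF assms]
  obtain B where B: "B \<in> H" "A \<subseteq> B" "\<forall>C\<in>H. B \<subseteq> C \<longrightarrow> B = C" by blast
  then have "is_base H B" by (auto simp: is_base_def)
  moreover have "finite {B. is_base H B}"
    by (rule finite_subset[OF _ assms(1)]) (auto simp: is_base_def)
  ultimately have "mu H \<le> card B" by (auto simp: mu_def intro: Min_le)
  with B that show thesis by blast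
qed

text \<open>Double counting: each \<open>A\<close> containing \<open>R \<union> T\<close> lies in a
  member of \<open>H\<close> with at least \<open>mu H\<close> elements. Swapping \<open>T\<close>
  for an equally large \<open>U\<close> taken from that member outside \<open>A\<close> gives a set
  that still contains \<open>R\<close> but misses \<open>T\<close>. One binomial coefficient bounds
  the choices of \<open>U\<close> from below; the other counts the places of \<open>U\<close> in a
  given resulting set.\<close>

lemma exchange_level:
  assumes fin: "finite H" "\<And>A. A \<in> H \<Longrightarrow> finite A" and "hereditary H"
    and T: "finite T" "R \<inter> T = {}"
  shows "card {A \<in> level H s. R \<union> T \<subseteq> A} * (mu H - s choose card T)
    \<le> (s - card R choose card T) * card {A \<in> level H s. R \<subseteq> A \<and> A \<inter> T = {}}"
    (is "card ?X * ?p \<le> ?q * card ?Y")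
proof -
  have finlev: "finite (level H s)" using fin by (auto simp: level_def)
  then have finX: "finite ?X" and finY: "finite ?Y" by auto
  have "\<forall>A\<in>?X. \<exists>B. B \<in> H \<and> A \<subseteq> B \<and> mu H \<le> card B"
    using ex_base_ge_mu[OF fin(1)] unfolding level_def by (smt (verit) mem_Collect_eq)
  then obtain g where g: "\<And>A. A \<in> ?X \<Longrightarrow> g A \<in> H \<and> A \<subseteq> g A \<and> mu H \<le> card (g A)"
    by metis
  define P where "P = (SIGMA A:?X. {U. U \<subseteq> g A - A \<and> card U = card T})"
  define Q where "Q = (SIGMA C:?Y. {U. U \<subseteq> C - R \<and> card U = card T})"
  define h where "h = (\<lambda>(A, U). ((A - T) \<union> U, U))"
  have finA: "finite A" and cardA: "card A = s" if "A \<in> ?X \<or> A \<in> ?Y" for A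
    using that fin by (auto simp: level_def)
  have finQ: "finite Q"
    unfolding Q_def using finA
    by (intro finite_SigmaI finY) (auto intro!: finite_subset[OF _ finite_Pow_iff[THEN iffD2]])
  have "card ?X * ?p \<le> card P"
  proof -
    have "?p \<le> card {U. U \<subseteq> g A - A \<and> card U = card T}" if "A \<in> ?X" for A
    proof -
      have "card (g A - A) = card (g A) - s"
        using g[OF that] cardA finA that by (simp add: card_Diff_subset)
      moreover have "finite (g A - A)" using g[OF that] fin by auto
      ultimately show ?thesis using g[OF that] by (simp add: n_subsets binomial_right_mono diff_le_mono)
    qed
    then have "card ?X * ?p \<le> (\<Sum>A\<in>?X. card {U. U \<subseteq> g A - A \<and> card U = card T})"
      by (metis (no_types, lifting) sum_bounded_below of_nat_id)
    also have "\<dots> = card P"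
      unfolding P_def using finX g fin by (subst card_SigmaI) auto
    finally show ?thesis .
  qed
  also have "card P \<le> card Q"
  proof (rule card_inj_on_le[OF _ _ finQ])
    \<comment> \<open>Since \<open>U\<close> avoids \<open>A\<close> and
      \<open>T \<subseteq> A\<close>, the image \<open>(C, U)\<close> determines \<open>A\<close> as
      \<open>(C - U) \<union> T\<close>.\<close>
    show "inj_on h P"
    proof (rule inj_onI)
      fix x y assume "x \<in> P" "y \<in> P" "h x = h y"
      then show "x = y" by (cases x; cases y) (simp add: P_def h_def, blast)
    qed
    show "h ` P \<subseteq> Q"
    proof
      fix z assume "z \<in> h ` P"
      then obtain A U where A: "A \<in> ?X" and U: "U \<subseteq> g A - A" "card U = card T"
        and z: "z = ((A - T) \<union> U, U)" by (auto simp: P_def h_def)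
      have "finite U" using U(1) g[OF A] fin by (meson finite_Diff finite_subset)
      moreover have "T \<subseteq> A" using A by auto
      ultimately have "card ((A - T) \<union> U) = card A"
        using U finA A T card_mono[of A T]
        by (subst card_Un_disjoint) (auto simp: card_Diff_subset)
      then have "card ((A - T) \<union> U) = s" using cardA A by simp
      \<comment> \<open>The new set is a subset of \<open>g A\<close>, so heredity applies.\<close>
      moreover have "(A - T) \<union> U \<in> H"
        using assms(3) g[OF A] U(1) unfolding hereditary_def by (metis Diff_subset Un_least subset_trans)
      ultimately have "(A - T) \<union> U \<in> ?Y"
        using A U T \<open>T \<subseteq> A\<close> by (auto simp: level_def)
      then show "z \<in> Q" using A U by (auto simp: Q_def z)
    qed
  qed
  also have "card Q = (\<Sum>C\<in>?Y. card {U. U \<subseteq> C - R \<and> card U = card T})"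
    unfolding Q_def using finY finA by (subst card_SigmaI) auto
  also have "\<dots> = (\<Sum>C\<in>?Y. ?q)"
  proof (rule sum.cong)
    fix C assume C: "C \<in> ?Y"
    then have "finite C" "R \<subseteq> C" "card C = s" using finA cardA by auto
    then show "card {U. U \<subseteq> C - R \<and> card U = card T} = ?q"
      by (subst n_subsets) (auto simp: card_Diff_subset finite_subset)
  qed simp
  finally show ?thesis by (simp add: mult.commute)
qed

text \<open>Distinct levels are disjoint, so the inequalities for the single levels add up once both
  binomial coefficients are replaced by their worst case \<open>s = r\<close>.\<close>

lemma exchange_Union_levels:
  assumes fin: "finite H" "\<And>A. A \<in> H \<Longrightarrow> finite A" and "hereditary H"
    and T: "finite T" "R \<inter> T = {}" and S: "S \<subseteq> {..r}"
  shows "card {A \<in> (\<Union>s\<in>S. level H s). R \<union> T \<subseteq> A} * (mu H - r choose card T)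
    \<le> (r - card R choose card T) * card {A \<in> (\<Union>s\<in>S. level H s). R \<subseteq> A \<and> A \<inter> T = {}}"
proof -
  have finS: "finite S" using S finite_subset by blast
  have split: "card {A \<in> (\<Union>s\<in>S. level H s). P A} = (\<Sum>s\<in>S. card {A \<in> level H s. P A})" for P
  proof -
    have "{A \<in> (\<Union>s\<in>S. level H s). P A} = (\<Union>s\<in>S. {A \<in> level H s. P A})" by auto
    then show ?thesis
      using finS fin by (subst card_UN_disjoint[symmetric]) (auto simp: level_def)
  qed
  have "card {A \<in> level H s. R \<union> T \<subseteq> A} * (mu H - r choose card T)
    \<le> (r - card R choose card T) * card {A \<in> level H s. R \<subseteq> A \<and> A \<inter> T = {}}" if "s \<in> S" for s
  proof -
    have "s \<le> r" using that S by auto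
    then have "(mu H - r choose card T) \<le> (mu H - s choose card T)"
      "(s - card R choose card T) \<le> (r - card R choose card T)"
      by (auto intro!: binomial_right_mono)
    then show ?thesis using exchange_level[OF fin assms(3) T, of s]
      by (meson le_trans mult_le_mono1 mult_le_mono2)
  qed
  then show ?thesis
    unfolding split sum_distrib_left sum_distrib_right by (rule sum_mono)
qed

section \<open>Binomial estimates\<close>

text \<open>Compare the products factor by factor: \<open>(r - i) * n \<le> (n - i) * r\<close> for
  \<open>r \<le> n\<close>. For \<open>t > r\<close> the left side is 0.\<close>

lemma binomial_ratio_power_le:
  assumes "r \<le> n"
  shows "(r choose t) * n ^ t \<le> (n choose t) * r ^ t"
proof (cases "t \<le> r")
  case True
  have "real ((r choose t) * n ^ t) = (\<Prod>i<t. real (r - i) / real (t - i) * real n)"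
    using True by (simp add: binomial_altdef_of_nat prod.distrib prod_dividef atLeast0LessThan del: of_nat_diff)
  also have "\<dots> \<le> (\<Prod>i<t. real (n - i) / real (t - i) * real r)"
  proof (rule prod_mono, safe)
    fix i assume "i < t"
    then have "real (r - i) * real n \<le> real (n - i) * real r"
      using assms True by (simp add: of_nat_diff algebra_simps mult_left_mono)
    then show "real (r - i) / real (t - i) * real n \<le> real (n - i) / real (t - i) * real r"
      by (simp add: divide_right_mono)
  qed simp
  also have "\<dots> = real ((n choose t) * r ^ t)"
    using True assms by (simp add: binomial_altdef_of_nat prod.distrib prod_dividef atLeast0LessThan del: of_nat_diff)
  finally show ?thesis by (simp only: of_nat_le_iff)
qed (simp add: binomial_eq_0)

lemma binomial_mult_le_of_power_le:
  assumes "0 < r" "r \<le> n" "m * r ^ t \<le> n ^ t"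
  shows "m * (r choose t) \<le> (n choose t)"
proof -
  have "m * (r choose t) * r ^ t \<le> (r choose t) * n ^ t"
    using assms(3) by (simp add: mult_ac mult_le_mono2)
  also note binomial_ratio_power_le[OF assms(2)]
  finally show ?thesis using assms(1) by simp
qed

text \<open>The right side dominates a single Vandermonde term: \<open>t\<close> elements from one
  half of a \<open>2 * r\<close>-set and one from the other half.\<close>

lemma mult_binomial_le_binomial_double: "r * (r choose t) \<le> (2 * r choose (t + 1))"
proof -
  have "(r choose t) * (r choose (t + 1 - t)) \<le> (\<Sum>i\<le>t + 1. (r choose i) * (r choose (t + 1 - i)))"
    by (rule member_le_sum) auto
  also have "\<dots> = (r + r choose (t + 1))" by (rule vandermonde)
  finally show ?thesis unfolding mult_2 by (simp add: mult.commute)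
qed

section \<open>Covering families by stars\<close>

text \<open>Union bound in which each part has size at most \<open>q / w\<close>; clearing the
  denominator keeps all estimates in the natural numbers.\<close>

lemma weighted_card_UN_le:
  fixes w q :: nat
  assumes "finite I" "X \<subseteq> (\<Union>i\<in>I. Y i)" "\<And>i. i \<in> I \<Longrightarrow> finite (Y i)"
    "\<And>i. i \<in> I \<Longrightarrow> w * card (Y i) \<le> q"
  shows "w * card X \<le> card I * q"
proof -
  have "card X \<le> card (\<Union>i\<in>I. Y i)" using assms by (intro card_mono) auto
  also have "\<dots> \<le> (\<Sum>i\<in>I. card (Y i))" using assms(1) by (rule card_UN_le)
  finally have "w * card X \<le> (\<Sum>i\<in>I. w * card (Y i))"
    by (simp add: sum_distrib_left[symmetric])
  also have "\<dots> \<le> card I * q" using sum_bounded_above[of I _ q] assms(4) by auto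
  finally show ?thesis .
qed

text \<open>Every member of \<open>X\<close> contains one of the \<open>t\<close>-subsets of
  \<open>B\<close>, so the stars of these subsets cover \<open>X\<close>.\<close>

lemma t_intersecting_set_card_le:
  fixes w q :: nat
  assumes "finite X" "finite B" "\<And>A. A \<in> X \<Longrightarrow> t \<le> card (A \<inter> B)"
    "\<And>T. T \<subseteq> B \<Longrightarrow> card T = t \<Longrightarrow> w * card {A \<in> X. T \<subseteq> A} \<le> q"
  shows "w * card X \<le> (card B choose t) * q"
proof -
  have "w * card X \<le> card {T. T \<subseteq> B \<and> card T = t} * q"
  proof (rule weighted_card_UN_le[where Y = "\<lambda>T. {A \<in> X. T \<subseteq> A}"])
    show "X \<subseteq> (\<Union>T\<in>{T. T \<subseteq> B \<and> card T = t}. {A \<in> X. T \<subseteq> A})"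
    proof
      fix A assume "A \<in> X"
      then obtain T where "T \<subseteq> A \<inter> B" "card T = t"
        using assms(3) by (meson obtain_subset_with_card_n)
      then show "A \<in> (\<Union>T\<in>{T. T \<subseteq> B \<and> card T = t}. {A \<in> X. T \<subseteq> A})" using \<open>A \<in> X\<close> by auto
    qed
  qed (use assms in auto)
  then show ?thesis using assms(2) by (simp add: n_subsets)
qed

text \<open>As \<open>T\<close> is not inside \<open>B\<close>, fewer than \<open>t\<close> elements
  of \<open>B\<close> lie in \<open>T\<close>. Each \<open>A\<close> must therefore meet
  \<open>B\<close> outside \<open>T\<close>, which leaves at most \<open>card B\<close> choices for
  an extra element.\<close>

lemma star_t_intersecting_set_card_le:
  fixes w q :: nat
  assumes "finite X" "finite T" "card T = t" "finite B" "\<not> T \<subseteq> B"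
    "\<And>A. A \<in> X \<Longrightarrow> T \<subseteq> A \<and> t \<le> card (A \<inter> B)"
    "\<And>x. x \<notin> T \<Longrightarrow> w * card {A \<in> X. insert x T \<subseteq> A} \<le> q"
  shows "w * card X \<le> card B * q"
proof -
  have "w * card X \<le> card (B - T) * q"
  proof (rule weighted_card_UN_le[where Y = "\<lambda>x. {A \<in> X. insert x T \<subseteq> A}"])
    show "X \<subseteq> (\<Union>x\<in>B - T. {A \<in> X. insert x T \<subseteq> A})"
    proof
      fix A assume A: "A \<in> X"
      have "\<not> A \<inter> B \<subseteq> T"
      proof
        assume "A \<inter> B \<subseteq> T"
        then have "A \<inter> B \<subset> T" using assms(5) by auto
        then have "card (A \<inter> B) < t" using assms(2,3) psubset_card_mono by blast
        then show False using assms(6)[OF A] by simp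
      qed
      then show "A \<in> (\<Union>x\<in>B - T. {A \<in> X. insert x T \<subseteq> A})" using A assms(6) by auto
    qed
  qed (use assms in auto)
  also have "\<dots> \<le> card B * q" using assms(4) by (intro mult_le_mono1 card_mono) auto
  finally show ?thesis .
qed

section \<open>The strict bound for at least two nonempty families\<close>

text \<open>The underlying family enters through the star bounds alone. In \<open>star_Suc\<close>
  the factor \<open>r\<close> pays for choosing an extra element, \<open>c\<close> for choosing a
  \<open>t\<close>-subset, and 2 gains a half for the families beside an exceptional one.\<close>

lemma sum_card_cross_t_intersecting_less:
  fixes \<F> \<A> :: "'i \<Rightarrow> 'a set set" and t r K M :: nat
  assumes I: "finite I" "card I \<le> K"
    and r: "0 < r" "t \<le> r" "2 * (r choose t) \<le> K"
    and fin: "\<And>i. i \<in> I \<Longrightarrow> finite (\<F> i)"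
      "\<And>i A. i \<in> I \<Longrightarrow> A \<in> \<F> i \<Longrightarrow> finite A \<and> card A \<le> r"
    and cross: "cross_t_intersecting t I \<A>"
    and sub: "\<And>i. i \<in> I \<Longrightarrow> \<A> i \<subseteq> \<F> i"
    and star: "\<And>i T. i \<in> I \<Longrightarrow> finite T \<Longrightarrow> card T = t \<Longrightarrow>
      (K + 1) * card {A \<in> \<F> i. T \<subseteq> A} \<le> M"
    and star_Suc: "\<And>i T x. i \<in> I \<Longrightarrow> finite T \<Longrightarrow> card T = t \<Longrightarrow> x \<notin> T \<Longrightarrow>
      max 2 (r choose t) * r * (K + 1) * card {A \<in> \<F> i. insert x T \<subseteq> A} \<le> M"
    and two: "\<And>i. i \<in> I \<Longrightarrow> \<exists>l\<in>I - {i}. \<A> l \<noteq> {}"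
    and M: "0 < M"
  shows "(\<Sum>i\<in>I. card (\<A> i)) < M"
proof -
  define c where "c = (r choose t)"
  have c: "0 < c" using r by (simp add: c_def)
  have int: "t \<le> card (A \<inter> B)" if "i \<in> I" "l \<in> I" "i \<noteq> l" "A \<in> \<A> i" "B \<in> \<A> l" for i l A B
    using cross that by (auto simp: cross_t_intersecting_def t_intersects_def)
  have finA: "finite (\<A> i)" if "i \<in> I" for i
    using fin(1)[OF that] sub[OF that] finite_subset by blast
  have fins: "finite A" "card A \<le> r" if "i \<in> I" "A \<in> \<A> i" for i A
    using fin(2) sub that by blast+
  have starA: "(K + 1) * card {A \<in> \<A> i. T \<subseteq> A} \<le> M" if "i \<in> I" "finite T" "card T = t" for i T
  proof -
    have "card {A \<in> \<A> i. T \<subseteq> A} \<le> card {A \<in> \<F> i. T \<subseteq> A}"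
      using fin(1) sub that by (intro card_mono) auto
    then show ?thesis using star[OF that] by (meson le_trans mult_le_mono2)
  qed
  have star_SucA: "w * r * (K + 1) * card {A \<in> \<A> i. insert x T \<subseteq> A} \<le> M"
    if "i \<in> I" "finite T" "card T = t" "x \<notin> T" "w = 2 \<or> w = c" for i T x w
  proof -
    have "card {A \<in> \<A> i. insert x T \<subseteq> A} \<le> card {A \<in> \<F> i. insert x T \<subseteq> A}"
      using fin(1) sub that by (intro card_mono) auto
    then have "w * r * (K + 1) * card {A \<in> \<A> i. insert x T \<subseteq> A}
      \<le> max 2 (r choose t) * r * (K + 1) * card {A \<in> \<F> i. insert x T \<subseteq> A}"
      using that(5) by (intro mult_le_mono) (auto simp: c_def)
    then show ?thesis using star_Suc[OF that(1-4)] by (rule le_trans)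
  qed
  \<comment> \<open>There are at most \<open>K\<close> families, so a share of
    \<open>M / (K + 1)\<close> for each leaves strict room.\<close>
  have small: ?thesis if "\<And>i. i \<in> I \<Longrightarrow> (K + 1) * card (\<A> i) \<le> M"
  proof -
    have "(K + 1) * (\<Sum>i\<in>I. card (\<A> i)) \<le> card I * M"
      unfolding sum_distrib_left using sum_bounded_above[of I _ M] that by auto
    also have "\<dots> < (K + 1) * M" using I M by (intro mult_less_mono1) auto
    finally show ?thesis by (simp only: mult_less_cancel1)
  qed
  show ?thesis
  \<comment> \<open>The index \<open>i\<close> is the possible exception: nothing is asked of the
    members of \<open>\<A> i\<close>.\<close>
  proof (cases "\<exists>i\<in>I. \<exists>T. finite T \<and> card T = t \<and> (\<forall>l\<in>I - {i}. \<forall>B\<in>\<A> l. T \<subseteq> B)")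
    case True
    then obtain i T where i: "i \<in> I" and T: "finite T" "card T = t"
      and sup: "\<And>l B. l \<in> I \<Longrightarrow> l \<noteq> i \<Longrightarrow> B \<in> \<A> l \<Longrightarrow> T \<subseteq> B" by blast
    show ?thesis
    proof (cases "\<forall>A\<in>\<A> i. T \<subseteq> A")
      case True
      then have "{A \<in> \<A> l. T \<subseteq> A} = \<A> l" if "l \<in> I" for l
        using sup that by (cases "l = i") auto
      then show ?thesis using small starA[OF _ T] by metis
    next
      case False
      then obtain A where A: "A \<in> \<A> i" "\<not> T \<subseteq> A" by auto
      \<comment> \<open>Every member of \<open>\<A> l\<close> contains \<open>T\<close> and
        \<open>t\<close>-intersects \<open>A\<close>, which does not contain \<open>T\<close>; hence
        it also contains one of at most \<open>r\<close> elements of \<open>A\<close> outside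
        \<open>T\<close>.\<close>
      have others: "2 * (K + 1) * card (\<A> l) \<le> M" if l: "l \<in> I - {i}" for l
      proof -
        have "2 * r * (K + 1) * card (\<A> l) \<le> card A * M"
        proof (rule star_t_intersecting_set_card_le[OF _ T _ A(2)])
          show "T \<subseteq> B \<and> t \<le> card (B \<inter> A)" if "B \<in> \<A> l" for B
            using sup int[of l i B A] that l i A by auto
        qed (use l i A finA fins star_SucA[OF _ T] in auto)
        also have "\<dots> \<le> r * M" using fins(2)[OF i A(1)] by simp
        finally have "r * (2 * (K + 1) * card (\<A> l)) \<le> r * M" by (simp only: mult.assoc mult.left_commute[of r])
        then show ?thesis using r(1) by (simp only: mult_le_cancel1 simp_thms)
      qed
      have first: "(K + 1) * card (\<A> i) \<le> c * M"
      proof -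
        obtain l B where l: "l \<in> I" "l \<noteq> i" and B: "B \<in> \<A> l" using two[OF i] by auto
        have "(K + 1) * card (\<A> i) \<le> (card B choose t) * M"
        proof (rule t_intersecting_set_card_le)
          show "(K + 1) * card {A \<in> \<A> i. U \<subseteq> A} \<le> M" if "U \<subseteq> B" "card U = t" for U
            using that starA i fins(1)[OF l(1) B] finite_subset by blast
        qed (use int[OF i l(1)] l B finA[OF i] fins[OF l(1) B] in auto)
        also have "\<dots> \<le> c * M"
          unfolding c_def using fins(2)[OF l(1) B] by (intro mult_le_mono1 binomial_right_mono)
        finally show ?thesis .
      qed
      \<comment> \<open>Doubling avoids halves: the exceptional family contributes at most
        \<open>2 * c * M\<close> and the others together at most \<open>K * M\<close>, so
        \<open>2 * c \<le> K\<close> suffices.\<close>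
      have "2 * (K + 1) * (\<Sum>l\<in>I. card (\<A> l))
        = 2 * ((K + 1) * card (\<A> i)) + (\<Sum>l\<in>I - {i}. 2 * (K + 1) * card (\<A> l))"
        unfolding sum.remove[OF I(1) i] by (simp add: algebra_simps sum_distrib_left)
      also have "\<dots> \<le> 2 * (c * M) + card (I - {i}) * M"
        using first others sum_bounded_above[of "I - {i}" _ M]
        by (intro add_mono mult_le_mono2) auto
      also have "\<dots> \<le> (K + K) * M"
      proof -
        have "card (I - {i}) \<le> K" using card_Diff1_le[of I i] I(2) by linarith
        then have "2 * c + card (I - {i}) \<le> K + K" using r(3) unfolding c_def by linarith
        then have "(2 * c + card (I - {i})) * M \<le> (K + K) * M" by (rule mult_le_mono1)
        then show ?thesis by (simp only: add_mult_distrib mult.assoc)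
      qed
      also have "\<dots> < 2 * (K + 1) * M" using M by (intro mult_less_mono1) auto
      finally show ?thesis by (simp only: mult_less_cancel1)
    qed
  next
    case False
    show ?thesis
    proof (rule small)
      fix i assume i: "i \<in> I"
      obtain l B where l: "l \<in> I" "l \<noteq> i" and B: "B \<in> \<A> l" using two[OF i] by auto
      have "c * (K + 1) * card (\<A> i) \<le> (card B choose t) * M"
      proof (rule t_intersecting_set_card_le)
        \<comment> \<open>By the negated case assumption for \<open>i\<close> and \<open>T\<close>,
          some \<open>B'\<close> in another family omits part of \<open>T\<close>. Covering by
          \<open>B'\<close> costs \<open>r\<close>, and the cover by \<open>t\<close>-subsets of
          \<open>B\<close> then costs \<open>c\<close>; \<open>star_Suc\<close> absorbs
          both.\<close>
        show "c * (K + 1) * card {A \<in> \<A> i. T \<subseteq> A} \<le> M" if T: "T \<subseteq> B" "card T = t" for T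
        proof -
          have finT: "finite T" using T(1) fins(1)[OF l(1) B] finite_subset by blast
          then obtain l' B' where l': "l' \<in> I" "l' \<noteq> i" and B': "B' \<in> \<A> l'" "\<not> T \<subseteq> B'"
            using False i T by blast
          have "c * r * (K + 1) * card {A \<in> \<A> i. T \<subseteq> A} \<le> card B' * M"
          proof (rule star_t_intersecting_set_card_le[OF _ finT T(2) _ B'(2)])
            show "c * r * (K + 1) * card {A \<in> {A \<in> \<A> i. T \<subseteq> A}. insert x T \<subseteq> A} \<le> M"
              if "x \<notin> T" for x
            proof -
              have "{A \<in> {A \<in> \<A> i. T \<subseteq> A}. insert x T \<subseteq> A} = {A \<in> \<A> i. insert x T \<subseteq> A}" by auto
              then show ?thesis using star_SucA[OF i finT T(2) that] by simp
            qed
          qed (use int[OF i l'(1)] l' B' finA[OF i] fins[OF l'(1) B'(1)] in auto)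
          also have "\<dots> \<le> r * M" using fins(2)[OF l'(1) B'(1)] by simp
          finally have "r * (c * (K + 1) * card {A \<in> \<A> i. T \<subseteq> A}) \<le> r * M" by (simp only: mult.assoc mult.left_commute[of r])
          then show ?thesis using r(1) by (simp only: mult_le_cancel1 simp_thms)
        qed
      qed (use int[OF i l(1)] l B finA[OF i] fins[OF l(1) B] in auto)
      also have "\<dots> \<le> c * M"
        unfolding c_def using fins(2)[OF l(1) B] by (intro mult_le_mono1 binomial_right_mono)
      finally have "c * ((K + 1) * card (\<A> i)) \<le> c * M" by (simp only: mult.assoc)
      then show "(K + 1) * card (\<A> i) \<le> M" using c by (simp only: mult_le_cancel1 simp_thms)
    qed
  qed
qed

section \<open>Numerical consequences of the bound on \<open>mu H\<close>, and the theorem\<close>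

lemma nat_power_ge_of_powr_le:
  assumes "0 < t" "real k powr (1 / real t) * real r \<le> real n"
  shows "k * r ^ t \<le> n ^ t"
proof (cases "k = 0")
  case False
  have "real k * real r ^ t = (real k powr (1 / real t) * real r) ^ t"
    using assms(1) False by (simp add: power_mult_distrib powr_power)
  also have "\<dots> \<le> real n ^ t" using assms(2) by (intro power_mono) auto
  finally show ?thesis by (metis of_nat_le_iff of_nat_mult of_nat_power)
qed simp

theorem theorem2p6:
  fixes t r k j :: nat
    and H :: "'a set set"
    and S :: "nat \<Rightarrow> nat set"
    and \<F> \<A> :: "nat \<Rightarrow> 'a set set"
  assumes "1 \<le> t" and "t \<le> r" and "2 \<le> k"
    and "finite H" and "\<And>A. A \<in> H \<Longrightarrow> finite A"
    and "hereditary H"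
    and "real (mu H) \<ge> max (real (n_S r t)) ((real k powr (1 / real t) + 1) * real r)"
    and "\<And>i. i \<in> {1..k} \<Longrightarrow> S i \<noteq> {} \<and> S i \<subseteq> {t..r}"
    and "\<And>i. i \<in> {1..k} \<Longrightarrow> \<F> i = (\<Union>s\<in>S i. level H s)"
    and "cross_t_intersecting t {1..k} \<A>"
    and "\<And>i. i \<in> {1..k} \<Longrightarrow> \<A> i \<subseteq> \<F> i"
    and "j \<in> {1..k}"
    and "\<And>i. i \<in> {1..k} \<Longrightarrow> card (\<F> i) \<le> card (\<F> j)"
  shows "(\<Sum>i=1..k. card (\<A> i)) \<le> card (\<F> j) \<and>
    ((\<Sum>i=1..k. card (\<A> i)) = card (\<F> j) \<longleftrightarrow>
      (\<exists>l\<in>{1..k}. card (\<F> l) = card (\<F> j) \<and> \<A> l = \<F> l \<and> (\<forall>i\<in>{1..k} - {l}. \<A> i = {})))"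
proof -
  define c where "c = (r choose t)"
  define K where "K = max k (2 * c)"
  define N where "N = mu H - r"
  define M where "M = card (\<F> j)"
  have r: "0 < r" and c: "0 < c" using assms(1,2) by (auto simp: c_def)
  have muS: "n_S r t \<le> mu H" using assms(7) by simp
  then have NS: "(r - t + 1) * (m_fun r t choose (t + 1)) \<le> N" and rmu: "r \<le> mu H"
    by (auto simp: n_S_def N_def)
  \<comment> \<open>\<open>m_fun r t\<close> is at least \<open>2 * r\<close>, so the lower bound
    \<open>n_S r t\<close> on \<open>mu H\<close> yields a multiple of \<open>r * c\<close>.\<close>
  have "r * c \<le> (2 * r choose (t + 1))"
    unfolding c_def by (rule mult_binomial_le_binomial_double)
  also have "\<dots> \<le> (m_fun r t choose (t + 1))" by (intro binomial_right_mono) (simp add: m_fun_def)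
  finally have "(r - t + 1) * (r * c) \<le> (r - t + 1) * (m_fun r t choose (t + 1))"
    by (rule mult_le_mono2)
  with NS have N: "(r - t + 1) * (r * c) \<le> N" by linarith
  have rN: "r \<le> N"
  proof -
    have "1 * (r * 1) \<le> (r - t + 1) * (r * c)" using c by (intro mult_le_mono) auto
    then show ?thesis using N by linarith
  qed
  have c2: "2 \<le> c" if "t < r"
  proof -
    have "(t + 1 choose t) \<le> c" unfolding c_def using that by (intro binomial_right_mono) simp
    then show ?thesis using assms(1) by simp
  qed
  have kN: "k * c \<le> (N choose t)"
    unfolding c_def
  proof (rule binomial_mult_le_of_power_le[OF r rN nat_power_ge_of_powr_le])
    show "real k powr (1 / real t) * real r \<le> real N"
      using assms(7) rmu by (simp add: N_def of_nat_diff algebra_simps)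
  qed (use assms(1) in simp)
  \<comment> \<open>For \<open>t = r\<close> we have \<open>c = 1\<close>, and
    \<open>k \<ge> 2\<close> suffices. Otherwise \<open>r - t + 1 \<ge> 2\<close> gives
    \<open>2 * c * r \<le> N\<close>, and \<open>t\<close>-th powers are compared.\<close>
  have cN: "2 * c * c \<le> (N choose t)"
  proof (cases "t = r")
    case True
    then have "c = 1" by (simp add: c_def)
    then show ?thesis using kN assms(3) by simp
  next
    case False
    have "2 * (r * c) \<le> (r - t + 1) * (r * c)" using False assms(2) by (intro mult_le_mono1) simp
    then have "2 * c * r \<le> N" using N by (simp only: mult_ac)
    then have "(2 * c * r) ^ t \<le> N ^ t" by (rule power_mono) simp
    moreover have "2 * c \<le> (2 * c) ^ t" using assms(1) c by (intro self_le_power) auto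
    ultimately have "2 * c * r ^ t \<le> N ^ t"
      by (simp only: power_mult_distrib) (meson le_trans mult_le_mono1)
    then show ?thesis using binomial_mult_le_of_power_le[OF r rN] unfolding c_def by blast
  qed
  have KN: "K * c \<le> (N choose t)" using kN cN by (simp add: K_def max_def)
  have lev: "\<F> i = (\<Union>s\<in>S i. level H s)" "S i \<subseteq> {..r}" if "i \<in> {1..k}" for i
    using assms(8,9)[OF that] by auto
  have finF: "finite (\<F> i)" "\<And>A. A \<in> \<F> i \<Longrightarrow> finite A \<and> card A \<le> r" if "i \<in> {1..k}" for i
  proof -
    have "\<F> i \<subseteq> H" using lev[OF that] by (auto simp: level_def)
    then show "finite (\<F> i)" using assms(4) finite_subset by blast
    show "\<And>A. A \<in> \<F> i \<Longrightarrow> finite A \<and> card A \<le> r"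
      using lev[OF that] assms(5) by (auto simp: level_def)
  qed
  have star: "(K + 1) * card {A \<in> \<F> i. T \<subseteq> A} \<le> M"
    if i: "i \<in> {1..k}" and T: "finite T" "card T = t" for i T
  proof -
    \<comment> \<open>Exchange with \<open>R = {}\<close>. As \<open>t \<ge> 1\<close>, the star of
      \<open>T\<close> and the sets missing \<open>T\<close> are disjoint parts of
      \<open>\<F> i\<close>, which turns the factor \<open>K\<close> into
      \<open>K + 1\<close>.\<close>
    have "card {A \<in> \<F> i. T \<subseteq> A} * (N choose t) \<le> c * card {A \<in> \<F> i. A \<inter> T = {}}"
      using exchange_Union_levels[OF assms(4,5,6) T(1) _ lev(2)[OF i], of "{}"] lev(1)[OF i] T(2)
      by (simp add: N_def c_def)
    then have "card {A \<in> \<F> i. T \<subseteq> A} * (K * c) \<le> c * card {A \<in> \<F> i. A \<inter> T = {}}"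
      using KN by (meson le_trans mult_le_mono2)
    then have "K * card {A \<in> \<F> i. T \<subseteq> A} \<le> card {A \<in> \<F> i. A \<inter> T = {}}"
      using c by (simp add: mult_ac)
    moreover have "card {A \<in> \<F> i. T \<subseteq> A} + card {A \<in> \<F> i. A \<inter> T = {}} \<le> card (\<F> i)"
    proof -
      have "T \<noteq> {}" using T assms(1) by auto
      then have "card {A \<in> \<F> i. T \<subseteq> A} + card {A \<in> \<F> i. A \<inter> T = {}}
        = card ({A \<in> \<F> i. T \<subseteq> A} \<union> {A \<in> \<F> i. A \<inter> T = {}})"
        using finF[OF i] by (subst card_Un_disjoint) auto
      also have "\<dots> \<le> card (\<F> i)" using finF[OF i] by (intro card_mono) auto
      finally show ?thesis .
    qed
    ultimately show ?thesis using assms(13)[OF i] by (simp add: M_def)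
  qed
  have star_Suc: "max 2 (r choose t) * r * (K + 1) * card {A \<in> \<F> i. insert x T \<subseteq> A} \<le> M"
    if i: "i \<in> {1..k}" and T: "finite T" "card T = t" and x: "x \<notin> T" for i T x
  proof -
    let ?u = "card {A \<in> \<F> i. insert x T \<subseteq> A}" and ?v = "card {A \<in> \<F> i. T \<subseteq> A}"
    \<comment> \<open>Here \<open>T\<close> is kept fixed as \<open>R\<close>, and the single
      element \<open>x\<close> is exchanged.\<close>
    have "?u * N \<le> (r - t) * card {A \<in> \<F> i. T \<subseteq> A \<and> A \<inter> {x} = {}}"
      using exchange_Union_levels[OF assms(4,5,6) _ _ lev(2)[OF i], of "{x}" T] lev(1)[OF i] T(2) x
      by (simp add: N_def)
    also have "\<dots> \<le> (r - t) * ?v" using finF[OF i] by (intro mult_le_mono2 card_mono) auto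
    finally have uv: "?u * N \<le> (r - t) * ?v" .
    have "max 2 c * r * ?u \<le> ?v"
    proof (cases "t = r")
      case True
      \<comment> \<open>With \<open>r - t = 0\<close> and \<open>N > 0\<close>, the bound
        \<open>uv\<close> forces \<open>?u = 0\<close>.\<close>
      then show ?thesis using uv rN r by simp
    next
      case False
      then have tr: "t < r" using assms(2) by simp
      have "(r - t) * (max 2 c * r) \<le> N" using N c2[OF tr] by (simp add: max_def algebra_simps)
      then have "?u * ((r - t) * (max 2 c * r)) \<le> (r - t) * ?v"
        using uv by (meson le_trans mult_le_mono2)
      then have "(r - t) * (max 2 c * r * ?u) \<le> (r - t) * ?v" by (simp add: mult_ac)
      then show ?thesis using tr by simp
    qed
    then have "(K + 1) * (max 2 c * r * ?u) \<le> (K + 1) * ?v" by (rule mult_le_mono2)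
    also note star[OF i T]
    finally show ?thesis by (simp add: c_def algebra_simps)
  qed
  have sum_one: "(\<Sum>i=1..k. card (\<A> i)) = card (\<A> l)"
    if "l \<in> {1..k}" "\<forall>i\<in>{1..k} - {l}. \<A> i = {}" for l
    using that sum.remove[of "{1..k}" l "\<lambda>i. card (\<A> i)"] by simp
  show ?thesis
  proof (cases "\<exists>l\<in>{1..k}. \<forall>i\<in>{1..k} - {l}. \<A> i = {}")
    case True
    then obtain l where l: "l \<in> {1..k}" "\<forall>i\<in>{1..k} - {l}. \<A> i = {}" by blast
    have le: "card (\<A> l) \<le> card (\<F> l)" "card (\<F> l) \<le> card (\<F> j)"
      using card_mono[OF finF(1) assms(11)] assms(13) l(1) by auto
    have "\<A> l = \<F> l \<and> card (\<F> l) = card (\<F> j)" if "card (\<A> l) = card (\<F> j)"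
    proof -
      have "card (\<A> l) = card (\<F> l)" "card (\<F> l) = card (\<F> j)" using that le by linarith+
      then show ?thesis using card_subset_eq[OF finF(1)[OF l(1)] assms(11)[OF l(1)]] by blast
    qed
    then have "(\<Sum>i=1..k. card (\<A> i)) = card (\<F> j) \<longrightarrow> card (\<F> l) = card (\<F> j) \<and> \<A> l = \<F> l"
      using sum_one[OF l] by simp
    \<comment> \<open>A witness \<open>l'\<close> of the equality condition is not assumed to be the
      chosen \<open>l\<close>, so the sum is evaluated anew.\<close>
    moreover have "(\<Sum>i=1..k. card (\<A> i)) = card (\<F> j)"
      if "l' \<in> {1..k}" "card (\<F> l') = card (\<F> j)" "\<A> l' = \<F> l'" "\<forall>i\<in>{1..k} - {l'}. \<A> i = {}" for l'
      using sum_one[OF that(1,4)] that(2,3) by simp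
    ultimately show ?thesis using sum_one[OF l] le l by (intro conjI) (linarith, blast)
  next
    case False
    then have two: "\<exists>l\<in>{1..k} - {i}. \<A> l \<noteq> {}" if "i \<in> {1..k}" for i using that by blast
    obtain l where l: "l \<in> {1..k}" "\<A> l \<noteq> {}" using two[OF assms(12)] by blast
    then have "0 < card (\<F> l)" using finF(1) assms(11) by (metis card_gt_0_iff subset_empty)
    then have M: "0 < M" using assms(13)[OF l(1)] by (simp add: M_def)
    have "(\<Sum>i=1..k. card (\<A> i)) < M"
    proof (rule sum_card_cross_t_intersecting_less[where \<F> = \<F> and K = K and r = r])
      show "card {1..k} \<le> K" "2 * (r choose t) \<le> K" by (auto simp: K_def c_def)
    qed (use r assms(2) finF assms(10,11) star star_Suc two M in auto)
    \<comment> \<open>Both sides of the equivalence fail: the sum is strictly smaller, and a witness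
      \<open>l\<close> would leave all other families empty, contrary to the case.\<close>
    then show ?thesis using False by (auto simp: M_def)
  qed
qed

end
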